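(* Let $\varphi\in C^2(\overline{H^2})\cap C^\infty(H^2)$ satisfy $\varphi\ge0$ on $\overline{H^2}$, $\varphi(0,y)=0$ for all $y\in\mathbb{R}$, and $$\varphi_{xx}+\varphi_{yy}-\frac1x\varphi_x=0\quad\text{on }H^2.$$ Then there is a constant $A\ge 0$ with $\varphi(x,y)=A\,x^2$ for all $(x,y)\in\overline{H^2}$.
   Context: $H^2=\{(x,y)\in\mathbb{R}^2: x>0\}$ is the open right half-plane and $\overline{H^2}=\{x\ge0\}$ its closure. *)

theory Defs
  imports "HOL-Analysis.Analysis"
begin

definition dx :: "(real \<Rightarrow> real \<Rightarrow> real) \<Rightarrow> real \<Rightarrow> real \<Rightarrow> real" where
  "dx f = (\<lambda>x y. deriv (\<lambda>t. f t y) x)"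

definition dy :: "(real \<Rightarrow> real \<Rightarrow> real) \<Rightarrow> real \<Rightarrow> real \<Rightarrow> real" where
  "dy f = (\<lambda>x y. deriv (\<lambda>t. f x t) y)"

definition partials_exist_on :: "(real \<times> real) set \<Rightarrow> (real \<Rightarrow> real \<Rightarrow> real) \<Rightarrow> bool" where
  "partials_exist_on U f \<longleftrightarrow>
     (\<forall>(x,y)\<in>U. (\<lambda>t. f t y) differentiable (at x) \<and> (\<lambda>t. f x t) differentiable (at y))"

fun Ck_on :: "nat \<Rightarrow> (real \<times> real) set \<Rightarrow> (real \<Rightarrow> real \<Rightarrow> real) \<Rightarrow> bool" where
  "Ck_on 0 U f = continuous_on U (case_prod f)"
| "Ck_on (Suc n) U f = (continuous_on U (case_prod f) \<and> partials_exist_on U f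
                         \<and> Ck_on n U (dx f) \<and> Ck_on n U (dy f))"

definition smooth_on :: "(real \<times> real) set \<Rightarrow> (real \<Rightarrow> real \<Rightarrow> real) \<Rightarrow> bool" where
  "smooth_on U f \<longleftrightarrow> (\<forall>n. Ck_on n U f)"

definition ext_cont :: "(real \<times> real) set \<Rightarrow> (real \<Rightarrow> real \<Rightarrow> real) \<Rightarrow> bool" where
  "ext_cont U f \<longleftrightarrow> (\<exists>g. continuous_on (closure U) g \<and> (\<forall>p\<in>U. g p = case_prod f p))"

fun Ck_upto :: "nat \<Rightarrow> (real \<times> real) set \<Rightarrow> (real \<Rightarrow> real \<Rightarrow> real) \<Rightarrow> bool" where
  "Ck_upto 0 U f = (continuous_on U (case_prod f) \<and> ext_cont U f)"
| "Ck_upto (Suc n) U f = (continuous_on U (case_prod f) \<and> ext_cont U f \<and> partials_exist_on U f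
                         \<and> Ck_upto n U (dx f) \<and> Ck_upto n U (dy f))"

definition H2 :: "(real \<times> real) set" where
  "H2 = {p. fst p > 0}"

definition H2_closed :: "(real \<times> real) set" where
  "H2_closed = {p. fst p \<ge> 0}"

end

theory Submission
  imports Defs
begin

text \<open>
  Let \<open>I\<^sub>k(y, r)\<close> be the integral of \<open>\<phi>(r sin \<theta>, y + r cos \<theta>) sin \<theta> cos\<^sup>k \<theta>\<close> over
  \<open>0 \<le> \<theta> \<le> \<pi>\<close>. Integrating the equation over half-circles gives \<open>I\<^sub>0'' = 2 I\<^sub>0 / r\<^sup>2\<close>, and
  boundedness at \<open>r = 0\<close> leaves \<open>I\<^sub>0 = a(y) r\<^sup>2\<close>. The identity
  \<open>\<partial>\<^sub>y I\<^sub>k = \<partial>\<^sub>r I\<^sub>k\<^sub>+\<^sub>1 + ((k + 2) I\<^sub>k\<^sub>+\<^sub>1 - k I\<^sub>k\<^sub>-\<^sub>1) / r\<close>, which needs no equation, yields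
  \<open>I\<^sub>1 = a'(y) r\<^sup>3 / 5\<close>; since \<open>\<bar>I\<^sub>1\<bar> \<le> I\<^sub>0\<close> for \<open>\<phi> \<ge> 0\<close>, letting \<open>r \<rightarrow> \<infinity>\<close> forces
  \<open>a' = 0\<close>. Then \<open>\<phi> - A x\<^sup>2\<close> with \<open>A = 3 a / 4\<close> has \<open>I\<^sub>0 = 0\<close> for all \<open>y\<close> and \<open>r\<close>, hence
  all its \<open>I\<^sub>k\<close> vanish by the same identity, and it is zero by Weierstrass approximation.
\<close>

section \<open>Calculus on the closed half-plane\<close>

text \<open>Being \<open>C^1\<close> up to the boundary, phrased without one-sided derivatives:
  total differentiability is asked only in the interior, and \<open>X\<close>, \<open>Y\<close>
  carry the continuous extensions of the gradient. Second-order regularity is then the same relation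
  applied to \<open>X\<close> and to \<open>Y\<close>.\<close>

definition half_grad :: "(real \<times> real \<Rightarrow> real) \<Rightarrow> (real \<times> real \<Rightarrow> real) \<Rightarrow> (real \<times> real \<Rightarrow> real) \<Rightarrow> bool"
  where "half_grad f X Y \<longleftrightarrow>
    continuous_on H2_closed f \<and> continuous_on H2_closed X \<and> continuous_on H2_closed Y \<and>
    (\<forall>p\<in>H2. (f has_derivative (\<lambda>v. X p * fst v + Y p * snd v)) (at p))"

text \<open>The angle is measured from the positive y-axis about the boundary point
  \<open>(0, y)\<close>. Hence \<open>0 \<le> \<theta> \<le> pi\<close> sweeps a half-circle whose
  two ends lie on \<open>x = 0\<close>.\<close>

definition polar :: "real \<Rightarrow> real \<Rightarrow> real \<Rightarrow> real \<times> real"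
  where "polar y r \<theta> = (r * sin \<theta>, y + r * cos \<theta>)"

lemma open_H2: "open H2"
proof -
  have "H2 = {p. inner (1, 0) p > (0::real)}"
    by (auto simp: H2_def inner_prod_def)
  then show ?thesis
    using open_halfspace_gt[of 0 "(1::real, 0::real)"] by simp
qed

lemma closure_H2: "closure H2 = H2_closed"
proof -
  have "H2 = {p. inner (1, 0) p > (0::real)}" "H2_closed = {p. inner (1, 0) p \<ge> (0::real)}"
    by (auto simp: H2_def H2_closed_def inner_prod_def)
  then show ?thesis
    by (metis closure_halfspace_gt one_neq_zero prod.sel(1) fst_zero)
qed

lemma H2_subset: "H2 \<subseteq> H2_closed"
  by (auto simp: H2_def H2_closed_def)

lemma half_gradD:
  assumes "half_grad f X Y"
  shows "continuous_on H2_closed f" "continuous_on H2_closed X" "continuous_on H2_closed Y"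
    "\<And>p. p \<in> H2 \<Longrightarrow> (f has_derivative (\<lambda>v. X p * fst v + Y p * snd v)) (at p)"
  using assms by (auto simp: half_grad_def)

lemma polar_mem_closed: "r \<ge> 0 \<Longrightarrow> \<theta> \<in> {0..pi} \<Longrightarrow> polar y r \<theta> \<in> H2_closed"
  by (auto simp: polar_def H2_closed_def sin_ge_zero)

lemma polar_mem: "r > 0 \<Longrightarrow> 0 < \<theta> \<Longrightarrow> \<theta> < pi \<Longrightarrow> polar y r \<theta> \<in> H2"
  by (auto simp: polar_def H2_def sin_gt_zero)

lemma continuous_on_half:
  assumes "continuous_on H2_closed f" "continuous_on S a" "continuous_on S b" "\<And>z. z \<in> S \<Longrightarrow> a z \<ge> 0"
  shows "continuous_on S (\<lambda>z. f (a z, b z))"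
  by (intro continuous_on_compose2[OF assms(1)] continuous_on_Pair assms(2,3))
    (auto simp: H2_closed_def assms(4))

lemma continuous_on_polar:
  fixes S :: "'a::t2_space set"
  assumes "continuous_on H2_closed f" "continuous_on S y" "continuous_on S r" "continuous_on S t"
    "\<And>z. z \<in> S \<Longrightarrow> r z \<ge> 0" "\<And>z. z \<in> S \<Longrightarrow> 0 \<le> t z \<and> t z \<le> pi"
  shows "continuous_on S (\<lambda>z. f (polar (y z) (r z) (t z)))"
  unfolding polar_def
  by (intro continuous_on_half[OF assms(1)] continuous_on_add continuous_on_mult assms(2,3)
      continuous_on_sin[OF assms(4)] continuous_on_cos[OF assms(4)])
    (auto intro!: mult_nonneg_nonneg sin_ge_zero simp: assms(5,6))

lemma half_grad_chain:
  assumes "half_grad f X Y" "(a has_real_derivative a') (at s)" "(b has_real_derivative b') (at s)"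
    "(a s, b s) \<in> H2"
  shows "((\<lambda>s. f (a s, b s)) has_real_derivative X (a s, b s) * a' + Y (a s, b s) * b') (at s)"
proof -
  have "((\<lambda>s. (a s, b s)) has_derivative (\<lambda>h. (a' * h, b' * h))) (at s)"
    using assms(2,3) by (intro has_derivative_Pair) (auto simp: has_field_derivative_def)
  from has_derivative_compose[OF this half_gradD(4)[OF assms(1,4)]]
  have "((\<lambda>s. f (a s, b s)) has_derivative (\<lambda>h. X (a s, b s) * (a' * h) + Y (a s, b s) * (b' * h))) (at s)"
    by simp
  moreover have "(\<lambda>h. X (a s, b s) * (a' * h) + Y (a s, b s) * (b' * h)) = (*) (X (a s, b s) * a' + Y (a s, b s) * b')"
    by (auto simp: algebra_simps)
  ultimately show ?thesis
    by (simp only: has_field_derivative_def)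
qed

text \<open>For \<open>x > 0\<close> the fundamental theorem on a segment parallel to the boundary
  gives \<open>f (x, b) - f (x, y)\<close> as the integral of \<open>Y (x, t)\<close> over
  \<open>y \<le> t \<le> b\<close>. Both sides are continuous up to \<open>x = 0\<close>, where the
  left one is zero. So \<open>Y (0, t)\<close> integrates to zero over every such segment.\<close>

lemma half_grad_boundary:
  assumes f: "half_grad f X Y" and z: "\<And>y. f (0, y) = 0"
  shows "Y (0, y) = 0"
proof -
  note c = half_gradD[OF f]
  have int0: "integral {y..b} (\<lambda>t. Y (0, t)) = 0" if "y \<le> b" for b
  proof -
    let ?g = "\<lambda>x. integral (cbox y b) (\<lambda>t. Y (x, t)) - (f (x, b) - f (x, y))"
    have "continuous_on {0..} (\<lambda>x. integral (cbox y b) (\<lambda>t. Y (x, t)))"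
      by (intro integral_continuous_on_param, unfold split_beta)
        (intro continuous_on_half[OF c(3)] continuous_intros, auto)
    moreover have "continuous_on {0..} (\<lambda>x. f (x, t))" for t
      by (intro continuous_on_half[OF c(1)] continuous_intros) auto
    ultimately have g: "continuous_on (closure {0<..}) ?g"
      by (simp add: continuous_on_diff)
    have "?g x = 0" if "x \<in> {0<..}" for x
    proof -
      have "((\<lambda>t. Y (x, t)) has_integral f (x, b) - f (x, y)) {y..b}"
      proof (rule fundamental_theorem_of_calculus[OF \<open>y \<le> b\<close>])
        fix t
        have "((\<lambda>s. f (x, s)) has_real_derivative X (x, t) * 0 + Y (x, t) * 1) (at t)"
          using that by (intro half_grad_chain[OF f]) (auto simp: H2_def intro!: derivative_eq_intros)
        then show "((\<lambda>s. f (x, s)) has_vector_derivative Y (x, t)) (at t within {y..b})"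
          by (simp add: has_real_derivative_iff_has_vector_derivative has_vector_derivative_at_within)
      qed
      then show ?thesis
        by (simp add: integral_unique)
    qed
    then have "?g 0 = 0"
      using continuous_constant_on_closure[OF g, of 0 0] by auto
    then show ?thesis
      using z by simp
  qed
  \<comment> \<open>A right-hand neighbourhood of \<open>y\<close> is enough: there the indefinite
    integral of \<open>Y (0, t)\<close> is identically zero, while its one-sided derivative at
    \<open>y\<close> is \<open>Y (0, y)\<close>.\<close>
  have "continuous_on {y..y+1} (\<lambda>t. Y (0, t))"
    by (intro continuous_on_half[OF c(3)] continuous_intros) auto
  from integral_has_vector_derivative[OF this, of y]
  have "((\<lambda>u. integral {y..u} (\<lambda>t. Y (0, t))) has_vector_derivative Y (0, y)) (at y within {y..y+1})"
    by simp
  moreover have "((\<lambda>u. 0) has_vector_derivative Y (0, y)) (at y within {y..y+1}) \<longleftrightarrow>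
    ((\<lambda>u. integral {y..u} (\<lambda>t. Y (0, t))) has_vector_derivative Y (0, y)) (at y within {y..y+1})"
    by (rule has_vector_derivative_cong_ev) (auto simp: int0 intro!: always_eventually)
  ultimately have "((\<lambda>u. 0) has_vector_derivative Y (0, y)) (at y within {y..y+1})"
    by simp
  moreover have "((\<lambda>u. 0) has_vector_derivative (0::real)) (at y within {y..y+1})"
    by (rule has_vector_derivative_const)
  ultimately show ?thesis
    using vector_derivative_unique_within[of y "{y..y+1}"]
    by (metis at_within_Icc_at_right less_add_one trivial_limit_at_right_real)
qed

section \<open>Differentiation of integrals over half-circles\<close>

text \<open>The chain rule covers \<open>0 < \<theta> < pi\<close>. At the two ends the point stays
  on the boundary, and the endpoint hypotheses leave two cases: the weight vanishes there, or
  \<open>f\<close> is zero on the whole boundary and then so is \<open>Y\<close> by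
  \<open>half_grad_boundary\<close>. In both cases the function and the claimed derivative are
  zero.\<close>

lemma polar_radial_derivative:
  assumes f: "half_grad f X Y" and r: "r > 0" and \<theta>: "\<theta> \<in> {0..pi}"
    and b: "\<And>y. f (0, y) * h 0 = 0" "\<And>y. f (0, y) * h pi = 0"
  shows "((\<lambda>r. f (polar y r \<theta>) * h \<theta>) has_real_derivative
    (X (polar y r \<theta>) * sin \<theta> + Y (polar y r \<theta>) * cos \<theta>) * h \<theta>) (at r)"
proof (cases "0 < \<theta> \<and> \<theta> < pi")
  case True
  have "((\<lambda>r. f (polar y r \<theta>)) has_real_derivative
      X (polar y r \<theta>) * sin \<theta> + Y (polar y r \<theta>) * cos \<theta>) (at r)"
    unfolding polar_def using polar_mem[of r \<theta> y] True r
    by (intro half_grad_chain[OF f]) (auto simp: polar_def intro!: derivative_eq_intros)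
  then show ?thesis
    by (rule DERIV_cmult_right)
next
  case False
  then have *: "\<theta> = 0 \<or> \<theta> = pi" using \<theta> by auto
  then have "h \<theta> = 0 \<or> (\<forall>y. f (0, y) = 0)"
    using b by (metis mult_eq_0_iff)
  then show ?thesis
  proof
    assume "\<forall>y. f (0, y) = 0"
    then show ?thesis
      using half_grad_boundary[OF f] * by (auto simp: polar_def)
  qed simp
qed

lemma polar_centre_derivative:
  assumes f: "half_grad f X Y" and r: "r > 0" and \<theta>: "\<theta> \<in> {0..pi}"
    and b: "\<And>y. f (0, y) * h 0 = 0" "\<And>y. f (0, y) * h pi = 0"
  shows "((\<lambda>y. f (polar y r \<theta>) * h \<theta>) has_real_derivative Y (polar y r \<theta>) * h \<theta>) (at y)"
proof (cases "0 < \<theta> \<and> \<theta> < pi")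
  case True
  have "((\<lambda>y. f (polar y r \<theta>)) has_real_derivative
      X (polar y r \<theta>) * 0 + Y (polar y r \<theta>) * 1) (at y)"
    unfolding polar_def using polar_mem[of r \<theta> y] True r
    by (intro half_grad_chain[OF f]) (auto simp: polar_def intro!: derivative_eq_intros)
  then show ?thesis
    using DERIV_cmult_right by fastforce
next
  case False
  then have *: "\<theta> = 0 \<or> \<theta> = pi" using \<theta> by auto
  then have "h \<theta> = 0 \<or> (\<forall>y. f (0, y) = 0)"
    using b by (metis mult_eq_0_iff)
  then show ?thesis
  proof
    assume "\<forall>y. f (0, y) = 0"
    then show ?thesis
      using half_grad_boundary[OF f] * by (auto simp: polar_def)
  qed simp
qed

lemma polar_integrable:
  fixes f :: "real \<times> real \<Rightarrow> real"
  assumes "continuous_on H2_closed f" "r \<ge> 0" "continuous_on {0..pi} h"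
  shows "(\<lambda>\<theta>. f (polar y r \<theta>) * h \<theta>) integrable_on {0..pi}"
  by (intro integrable_continuous_real continuous_on_mult continuous_on_polar[OF assms(1)] assms(3)
      continuous_intros) (auto simp: assms(2))

lemma integral_radial_derivative:
  assumes f: "half_grad f X Y" and r: "r > 0" and h: "continuous_on {0..pi} h"
    and b: "\<And>y. f (0, y) * h 0 = 0" "\<And>y. f (0, y) * h pi = 0"
  shows "((\<lambda>r. integral {0..pi} (\<lambda>\<theta>. f (polar y r \<theta>) * h \<theta>)) has_real_derivative
    integral {0..pi} (\<lambda>\<theta>. (X (polar y r \<theta>) * sin \<theta> + Y (polar y r \<theta>) * cos \<theta>) * h \<theta>)) (at r)"
proof -
  note c = half_gradD[OF f]
  have "continuous_on ({0<..} \<times> cbox 0 pi) (\<lambda>(r, \<theta>).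
      (X (polar y r \<theta>) * sin \<theta> + Y (polar y r \<theta>) * cos \<theta>) * h \<theta>)"
    unfolding split_beta
    by (intro continuous_intros continuous_on_polar[OF c(2)] continuous_on_polar[OF c(3)]
        continuous_on_compose2[OF h]) auto
  from leibniz_rule_field_derivative[OF _ _ this, where f = "\<lambda>r \<theta>. f (polar y r \<theta>) * h \<theta>" and ?x0.0 = r]
  show ?thesis
    using r polar_radial_derivative[OF f _ _ b] polar_integrable[OF c(1) _ h]
    by (auto simp: has_field_derivative_at_within at_within_open[of r "{0<..}"])
qed

lemma integral_centre_derivative:
  assumes f: "half_grad f X Y" and r: "r > 0" and h: "continuous_on {0..pi} h"
    and b: "\<And>y. f (0, y) * h 0 = 0" "\<And>y. f (0, y) * h pi = 0"
  shows "((\<lambda>y. integral {0..pi} (\<lambda>\<theta>. f (polar y r \<theta>) * h \<theta>)) has_real_derivative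
    integral {0..pi} (\<lambda>\<theta>. Y (polar y r \<theta>) * h \<theta>)) (at y)"
proof -
  note c = half_gradD[OF f]
  have "continuous_on (UNIV \<times> cbox 0 pi) (\<lambda>(y, \<theta>). Y (polar y r \<theta>) * h \<theta>)"
    unfolding split_beta
    by (intro continuous_intros continuous_on_polar[OF c(3)] continuous_on_compose2[OF h]) (use r in auto)
  from leibniz_rule_field_derivative[OF _ _ this, where f = "\<lambda>y \<theta>. f (polar y r \<theta>) * h \<theta>" and ?x0.0 = y]
  show ?thesis
    using r polar_centre_derivative[OF f r _ b] polar_integrable[OF c(1) _ h]
    by auto
qed

text \<open>The integrand is the angular derivative of \<open>f * h\<close> along the half-circle,
  and the endpoint hypotheses cancel the boundary terms. Since \<open>f\<close> has a derivative
  only inside the half-plane, the version of the fundamental theorem for open intervals is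
  used.\<close>

lemma integral_by_parts_polar:
  assumes f: "half_grad f X Y" and r: "r > 0" and h: "continuous_on {0..pi} h"
    and h': "\<And>\<theta>. (h has_real_derivative h' \<theta>) (at \<theta>)"
    and b: "\<And>y. f (0, y) * h 0 = 0" "\<And>y. f (0, y) * h pi = 0"
  shows "((\<lambda>\<theta>. r * (X (polar y r \<theta>) * cos \<theta> - Y (polar y r \<theta>) * sin \<theta>) * h \<theta> + f (polar y r \<theta>) * h' \<theta>)
    has_integral 0) {0..pi}"
proof -
  note c = half_gradD[OF f]
  have "((\<lambda>\<theta>. r * (X (polar y r \<theta>) * cos \<theta> - Y (polar y r \<theta>) * sin \<theta>) * h \<theta> + f (polar y r \<theta>) * h' \<theta>)
    has_integral (f (polar y r pi) * h pi - f (polar y r 0) * h 0)) {0..pi}"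
  proof (rule fundamental_theorem_of_calculus_interior)
    show "continuous_on {0..pi} (\<lambda>\<theta>. f (polar y r \<theta>) * h \<theta>)"
      using r by (intro continuous_intros continuous_on_polar[OF c(1)] h) auto
    fix \<theta> assume "\<theta> \<in> {0<..<pi}"
    then have "((\<lambda>\<theta>. f (polar y r \<theta>)) has_real_derivative
      X (polar y r \<theta>) * (r * cos \<theta>) + Y (polar y r \<theta>) * (- r * sin \<theta>)) (at \<theta>)"
      unfolding polar_def using polar_mem[of r \<theta> y] r
      by (intro half_grad_chain[OF f]) (auto simp: polar_def intro!: derivative_eq_intros)
    from DERIV_mult[OF this h']
    show "((\<lambda>\<theta>. f (polar y r \<theta>) * h \<theta>) has_vector_derivative
      r * (X (polar y r \<theta>) * cos \<theta> - Y (polar y r \<theta>) * sin \<theta>) * h \<theta> + f (polar y r \<theta>) * h' \<theta>) (at \<theta>)"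
      by (simp add: has_real_derivative_iff_has_vector_derivative[symmetric] algebra_simps)
  qed simp
  then show ?thesis
    using b by (simp add: polar_def)
qed

lemma integral_polar_bounded:
  fixes f :: "real \<times> real \<Rightarrow> real"
  assumes f: "continuous_on H2_closed f" and h: "continuous_on {0..pi} h"
  shows "\<exists>B. \<forall>r\<in>{0..1}. \<bar>integral {0..pi} (\<lambda>\<theta>. f (polar y r \<theta>) * h \<theta>)\<bar> \<le> B"
proof -
  have "continuous_on {0..1} (\<lambda>r. integral (cbox 0 pi) (\<lambda>\<theta>. f (polar y r \<theta>) * h \<theta>))"
    by (intro integral_continuous_on_param, unfold split_beta,
        intro continuous_on_mult continuous_on_polar[OF f] continuous_on_compose2[OF h] continuous_intros)
      auto
  then have "bounded ((\<lambda>r. integral (cbox 0 pi) (\<lambda>\<theta>. f (polar y r \<theta>) * h \<theta>)) ` {0..1})"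
    by (intro compact_imp_bounded compact_continuous_image) auto
  then show ?thesis
    by (auto simp: bounded_iff)
qed

text \<open>The uniqueness device for the radial equations below. There \<open>g\<close> is a
  solution times an integrating factor, minus a particular solution; boundedness of the moments near
  the centre gives the linear bound, which kills the constant of integration.\<close>

lemma constant_vanishing_at_0:
  fixes g :: "real \<Rightarrow> real"
  assumes d: "\<And>r. r > 0 \<Longrightarrow> (g has_real_derivative 0) (at r)"
    and b: "\<And>r. 0 < r \<Longrightarrow> r \<le> 1 \<Longrightarrow> \<bar>g r\<bar> \<le> C * r" and r: "r > 0"
  shows "g r = 0"
proof -
  have "\<exists>c. \<forall>x\<in>{0<..}. g x = c"
    using d by (intro has_field_derivative_zero_constant) (auto simp: has_field_derivative_at_within)
  then obtain c where c: "\<And>x. x > 0 \<Longrightarrow> g x = c"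
    by auto
  have "(\<lambda>n. C * (1 / real (Suc n))) \<longlonglongrightarrow> C * 0"
    by (intro tendsto_intros LIMSEQ_Suc lim_1_over_n)
  moreover have "\<bar>c\<bar> \<le> C * (1 / real (Suc n))" for n
    using b[of "1 / real (Suc n)"] c[of "1 / real (Suc n)"] by simp
  ultimately have "\<bar>c\<bar> \<le> C * 0"
    by (intro LIMSEQ_le_const) auto
  then show ?thesis
    using c r by simp
qed

section \<open>Moments over half-circles and their recurrence\<close>

text \<open>These are the \<open>I\<^sub>k\<close> of the overview. With
  \<open>t = cos \<theta>\<close> the factor \<open>sin \<theta>\<close> becomes the measure, so
  they are power moments in \<open>t\<close> on \<open>[-1, 1]\<close>.\<close>

definition moment :: "(real \<times> real \<Rightarrow> real) \<Rightarrow> nat \<Rightarrow> real \<Rightarrow> real \<Rightarrow> real"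
  where "moment f k y r = integral {0..pi} (\<lambda>\<theta>. f (polar y r \<theta>) * (sin \<theta> * cos \<theta> ^ k))"

lemma moment_centre_derivative:
  assumes "half_grad f X Y" "r > 0" "\<And>y. f (0, y) = 0"
  shows "((\<lambda>y. moment f k y r) has_real_derivative moment Y k y r) (at y)"
  unfolding moment_def
  by (rule integral_centre_derivative[OF assms(1,2)]) (auto intro!: continuous_intros simp: assms(3))

lemma moment_has_integral:
  assumes "continuous_on H2_closed f" "r > 0"
  shows "((\<lambda>\<theta>. f (polar y r \<theta>) * (sin \<theta> * cos \<theta> ^ k)) has_integral moment f k y r) {0..pi}"
  unfolding moment_def using assms
  by (intro integrable_integral polar_integrable) (auto intro!: continuous_intros)

text \<open>Along the half-circle the derivative in \<open>y\<close> is \<open>cos \<theta>\<close>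
  times the radial one minus \<open>sin \<theta> / r\<close> times the angular one. Multiplying by
  the weight of the \<open>k\<close>-th moment, the radial part is the derivative of moment
  \<open>k + 1\<close>, and the angular part is integrated by parts against
  \<open>sin^2 \<theta> cos^k \<theta>\<close>. At \<open>k = 0\<close> the truncated index
  \<open>k - 1\<close> is harmless, because its coefficient is zero.\<close>

lemma moment_radial_derivative:
  assumes f: "half_grad f X Y" and r: "r > 0" and z: "\<And>y. f (0, y) = 0"
  shows "((\<lambda>r. moment f (Suc k) y r) has_real_derivative
    moment Y k y r - (real (k + 2) * moment f (Suc k) y r - real k * moment f (k - 1) y r) / r) (at r)"
proof -
  note c = half_gradD[OF f]
  let ?X = "\<lambda>\<theta>. X (polar y r \<theta>)" and ?Y = "\<lambda>\<theta>. Y (polar y r \<theta>)" and ?f = "\<lambda>\<theta>. f (polar y r \<theta>)"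
  let ?h' = "\<lambda>\<theta>. 2 * sin \<theta> * cos \<theta> ^ Suc k - real k * (sin \<theta>) ^ 3 * cos \<theta> ^ (k - 1)"
  have "((\<lambda>\<theta>. r * (?X \<theta> * cos \<theta> - ?Y \<theta> * sin \<theta>) * ((sin \<theta>)\<^sup>2 * cos \<theta> ^ k) + ?f \<theta> * ?h' \<theta>)
      has_integral 0) {0..pi}"
    by (intro integral_by_parts_polar[OF f r])
      (auto intro!: continuous_intros derivative_eq_intros simp: z power2_eq_square power3_eq_cube)
  from has_integral_add[OF moment_has_integral[OF c(3) r, of y k]
      has_integral_diff[OF has_integral_mult_right[OF this, of "1 / r"]
        has_integral_mult_right[OF has_integral_diff[OF
          has_integral_mult_right[OF moment_has_integral[OF c(1) r, of y "Suc k"], of "real (k + 2)"]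
          has_integral_mult_right[OF moment_has_integral[OF c(1) r, of y "k - 1"], of "real k"]], of "1 / r"]]]
  have "((\<lambda>\<theta>. ?Y \<theta> * (sin \<theta> * cos \<theta> ^ k) +
      (1 / r * (r * (?X \<theta> * cos \<theta> - ?Y \<theta> * sin \<theta>) * ((sin \<theta>)\<^sup>2 * cos \<theta> ^ k) + ?f \<theta> * ?h' \<theta>)
      - 1 / r * (real (k + 2) * (?f \<theta> * (sin \<theta> * cos \<theta> ^ Suc k))
        - real k * (?f \<theta> * (sin \<theta> * cos \<theta> ^ (k - 1))))))
      has_integral moment Y k y r - (real (k + 2) * moment f (Suc k) y r - real k * moment f (k - 1) y r) / r)
      {0..pi}"
    (is "(?L has_integral _) _")
    by simp
  moreover have "?L \<theta> = (?X \<theta> * sin \<theta> + ?Y \<theta> * cos \<theta>) * (sin \<theta> * cos \<theta> ^ Suc k)" for \<theta>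
  proof -
    \<comment> \<open>Replacing \<open>sin^3\<close> by \<open>sin (1 - cos^2)\<close> turns the
      derivative of the by-parts weight into a combination of moment weights.\<close>
    have h': "?h' \<theta> = real (k + 2) * (sin \<theta> * cos \<theta> ^ Suc k) - real k * (sin \<theta> * cos \<theta> ^ (k - 1))"
    proof (cases k)
      case (Suc m)
      have "sin \<theta> ^ 3 = sin \<theta> * (1 - cos \<theta> * cos \<theta>)"
        using sin_squared_eq[of \<theta>] by (simp add: power3_eq_cube power2_eq_square)
      then show ?thesis
        by (simp only: Suc diff_Suc_1 power_Suc of_nat_Suc of_nat_add of_nat_numeral) (simp add: algebra_simps)
    qed simp
    have "?L \<theta> = ?Y \<theta> * sin \<theta> * cos \<theta> ^ k
        + (?X \<theta> * cos \<theta> - ?Y \<theta> * sin \<theta>) * ((sin \<theta>)\<^sup>2 * cos \<theta> ^ k)"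
      unfolding h' using r by (simp add: field_simps)
    also have "\<dots> = ?Y \<theta> * sin \<theta> * cos \<theta> ^ k * (1 - (sin \<theta>)\<^sup>2)
        + ?X \<theta> * cos \<theta> * ((sin \<theta>)\<^sup>2 * cos \<theta> ^ k)"
      by (simp add: algebra_simps)
    also have "1 - (sin \<theta>)\<^sup>2 = (cos \<theta>)\<^sup>2"
      by (simp add: sin_squared_eq)
    finally show ?thesis
      by (simp add: algebra_simps power2_eq_square)
  qed
  ultimately have i: "integral {0..pi} (\<lambda>\<theta>. (?X \<theta> * sin \<theta> + ?Y \<theta> * cos \<theta>) * (sin \<theta> * cos \<theta> ^ Suc k))
      = moment Y k y r - (real (k + 2) * moment f (Suc k) y r - real k * moment f (k - 1) y r) / r"
    by (simp add: integral_unique)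
  have "((\<lambda>r. moment f (Suc k) y r) has_real_derivative
      integral {0..pi} (\<lambda>\<theta>. (?X \<theta> * sin \<theta> + ?Y \<theta> * cos \<theta>) * (sin \<theta> * cos \<theta> ^ Suc k))) (at r)"
    unfolding moment_def
    by (rule integral_radial_derivative[OF f r]) (auto intro!: continuous_intros simp: z)
  then show ?thesis
    by (simp only: i)
qed

section \<open>The radial equation of the zeroth moment\<close>

text \<open>In polar coordinates, writing subscripts for derivatives, the equation is \<open>f_rr +
  (f_\<theta>\<theta> - cot \<theta> f_\<theta>) / r^2 = 0\<close>. Multiplied by
  \<open>sin \<theta>\<close> and integrated by parts, the angular terms contribute
  \<open>-2 / r^2\<close> times the zeroth moment. The first derivative \<open>N\<close> is split
  into an \<open>X\<close> and a \<open>Y\<close> integral because each can be differentiated again: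
  both weights vanish at the ends.\<close>

lemma zeroth_moment_second_derivative:
  fixes y :: real
  assumes f: "half_grad f X Y" and X: "half_grad X XX XY" and Y: "half_grad Y YX YY"
    and r: "r > 0" and z: "\<And>y. f (0, y) = 0"
    and pde: "\<And>p. p \<in> H2_closed \<Longrightarrow> fst p * (XX p + YY p) = X p"
  defines "N \<equiv> \<lambda>r. integral {0..pi} (\<lambda>\<theta>. X (polar y r \<theta>) * (sin \<theta>)\<^sup>2)
    + integral {0..pi} (\<lambda>\<theta>. Y (polar y r \<theta>) * (sin \<theta> * cos \<theta>))"
  shows "((\<lambda>r. moment f 0 y r) has_real_derivative N r) (at r)"
    "(N has_real_derivative 2 * moment f 0 y r / r\<^sup>2) (at r)"
proof -
  note cf = half_gradD[OF f] and cX = half_gradD[OF X] and cY = half_gradD[OF Y]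
  have N: "N r = integral {0..pi} (\<lambda>\<theta>. (X (polar y r \<theta>) * sin \<theta> + Y (polar y r \<theta>) * cos \<theta>) * sin \<theta>)"
  proof -
    have "(\<lambda>\<theta>. X (polar y r \<theta>) * (sin \<theta>)\<^sup>2) integrable_on {0..pi}"
      "(\<lambda>\<theta>. Y (polar y r \<theta>) * (sin \<theta> * cos \<theta>)) integrable_on {0..pi}"
      using r by (auto intro!: polar_integrable cX(1) cY(1) continuous_intros)
    from integral_add[OF this] show ?thesis
      unfolding N_def by (simp add: algebra_simps power2_eq_square)
  qed
  show "((\<lambda>r. moment f 0 y r) has_real_derivative N r) (at r)"
    unfolding moment_def N using integral_radial_derivative[OF f r continuous_on_sin[OF continuous_on_id], of y]
    by (simp add: z)
  let ?X = "\<lambda>\<theta>. X (polar y r \<theta>)" and ?Y = "\<lambda>\<theta>. Y (polar y r \<theta>)" and ?f = "\<lambda>\<theta>. f (polar y r \<theta>)"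
  let ?XX = "\<lambda>\<theta>. XX (polar y r \<theta>)" and ?XY = "\<lambda>\<theta>. XY (polar y r \<theta>)"
  let ?YX = "\<lambda>\<theta>. YX (polar y r \<theta>)" and ?YY = "\<lambda>\<theta>. YY (polar y r \<theta>)"
  have zY: "Y (0, y) = 0" for y
    by (rule half_grad_boundary[OF f z])
  let ?D1 = "\<lambda>\<theta>. (?XX \<theta> * sin \<theta> + ?XY \<theta> * cos \<theta>) * (sin \<theta>)\<^sup>2"
  let ?D2 = "\<lambda>\<theta>. (?YX \<theta> * sin \<theta> + ?YY \<theta> * cos \<theta>) * (sin \<theta> * cos \<theta>)"
  have "((\<lambda>r. integral {0..pi} (\<lambda>\<theta>. X (polar y r \<theta>) * (sin \<theta>)\<^sup>2))
      has_real_derivative integral {0..pi} ?D1) (at r)"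
    by (rule integral_radial_derivative[OF X r]) (auto intro!: continuous_intros)
  moreover have "((\<lambda>r. integral {0..pi} (\<lambda>\<theta>. Y (polar y r \<theta>) * (sin \<theta> * cos \<theta>)))
      has_real_derivative integral {0..pi} ?D2) (at r)"
    by (rule integral_radial_derivative[OF Y r]) (auto intro!: continuous_intros)
  ultimately have N': "(N has_real_derivative integral {0..pi} ?D1 + integral {0..pi} ?D2) (at r)"
    unfolding N_def by (rule DERIV_add)
  have e1: "((\<lambda>\<theta>. r * (?XX \<theta> * cos \<theta> - ?XY \<theta> * sin \<theta>) * (sin \<theta> * cos \<theta>)
      + ?X \<theta> * ((cos \<theta>)\<^sup>2 - (sin \<theta>)\<^sup>2)) has_integral 0) {0..pi}" (is "(?E1 has_integral 0) _")
  proof (rule integral_by_parts_polar[OF X r])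
    show "((\<lambda>\<theta>. sin \<theta> * cos \<theta>) has_real_derivative (cos \<theta>)\<^sup>2 - (sin \<theta>)\<^sup>2) (at \<theta>)" for \<theta> :: real
      by (rule DERIV_cong[OF DERIV_mult[OF DERIV_sin DERIV_cos]]) (simp add: power2_eq_square)
  qed (simp_all add: continuous_intros)
  have e2: "((\<lambda>\<theta>. r * (?YX \<theta> * cos \<theta> - ?YY \<theta> * sin \<theta>) * (sin \<theta>)\<^sup>2
      + ?Y \<theta> * (2 * sin \<theta> * cos \<theta>)) has_integral 0) {0..pi}" (is "(?E2 has_integral 0) _")
  proof (rule integral_by_parts_polar[OF Y r])
    show "((\<lambda>\<theta>. (sin \<theta>)\<^sup>2) has_real_derivative 2 * sin \<theta> * cos \<theta>) (at \<theta>)" for \<theta> :: real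
      by (rule DERIV_cong[OF DERIV_power[OF DERIV_sin]]) simp
  qed (simp_all add: continuous_intros)
  have e3: "((\<lambda>\<theta>. r * (?X \<theta> * cos \<theta> - ?Y \<theta> * sin \<theta>) * cos \<theta>
      + ?f \<theta> * (- sin \<theta>)) has_integral 0) {0..pi}" (is "(?E3 has_integral 0) _")
    by (rule integral_by_parts_polar[OF f r]) (simp_all add: z continuous_intros DERIV_cos)
  have d: "(?D1 has_integral integral {0..pi} ?D1) {0..pi}" "(?D2 has_integral integral {0..pi} ?D2) {0..pi}"
    by (intro integrable_integral integrable_continuous_real continuous_on_mult continuous_on_add
        continuous_on_polar[OF cX(2)] continuous_on_polar[OF cX(3)] continuous_on_polar[OF cY(2)]
        continuous_on_polar[OF cY(3)] continuous_intros; use r in auto)+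
  \<comment> \<open>Here \<open>r * (?E1 - ?E2)\<close> is the angular derivative of
    \<open>sin \<theta> f_\<theta>\<close>, and \<open>?E3\<close> that of
    \<open>cos \<theta> f\<close>, so the added terms integrate to zero. With these coefficients the
    mixed second derivatives cancel, leaving a multiple of the defect of the equation plus
    \<open>2 f sin \<theta>\<close>.\<close>
  have "((\<lambda>\<theta>. r * r * (?D1 \<theta> + ?D2 \<theta>) + (r * (?E1 \<theta> - ?E2 \<theta>) - 2 * ?E3 \<theta>))
      has_integral r * r * (integral {0..pi} ?D1 + integral {0..pi} ?D2) + (r * (0 - 0) - 2 * 0)) {0..pi}"
    by (rule has_integral_add[OF has_integral_mult_right[OF has_integral_add[OF d]]
          has_integral_diff[OF has_integral_mult_right[OF has_integral_diff[OF e1 e2]]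
            has_integral_mult_right[OF e3]]])
  moreover have "r * r * (?D1 \<theta> + ?D2 \<theta>) + (r * (?E1 \<theta> - ?E2 \<theta>) - 2 * ?E3 \<theta>)
      = 2 * (?f \<theta> * (sin \<theta> * cos \<theta> ^ 0))" if "\<theta> \<in> {0..pi}" for \<theta>
  proof -
    have p: "r * sin \<theta> * (?XX \<theta> + ?YY \<theta>) = ?X \<theta>"
      using pde[OF polar_mem_closed[of r \<theta> y]] r that by (simp add: polar_def)
    have "r * r * (?D1 \<theta> + ?D2 \<theta>) + (r * (?E1 \<theta> - ?E2 \<theta>) - 2 * ?E3 \<theta>)
      = r * ((sin \<theta>)\<^sup>2 + (cos \<theta>)\<^sup>2) * (r * sin \<theta> * (?XX \<theta> + ?YY \<theta>) - ?X \<theta>) + 2 * (?f \<theta> * sin \<theta>)"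
    proof -
      have "r * r * ((xx * s + xy * c) * s\<^sup>2 + (yx * s + yy * c) * (s * c))
        + (r * (r * (xx * c - xy * s) * (s * c) + x * (c\<^sup>2 - s\<^sup>2)
          - (r * (yx * c - yy * s) * s\<^sup>2 + y * (2 * s * c))) - 2 * (r * (x * c - y * s) * c + w * (- s)))
        = r * (s\<^sup>2 + c\<^sup>2) * (r * s * (xx + yy) - x) + 2 * (w * s)"
        for s c x y xx xy yx yy w :: real
        by (simp add: algebra_simps power2_eq_square)
      then show ?thesis .
    qed
    then show ?thesis
      by (simp add: p)
  qed
  ultimately have "((\<lambda>\<theta>. 2 * (?f \<theta> * (sin \<theta> * cos \<theta> ^ 0)))
      has_integral r * r * (integral {0..pi} ?D1 + integral {0..pi} ?D2) + (r * (0 - 0) - 2 * 0)) {0..pi}"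
    by (rule has_integral_eq[rotated])
  from has_integral_unique[OF this has_integral_mult_right[OF moment_has_integral[OF cf(1) r]]]
  have "r * r * (integral {0..pi} ?D1 + integral {0..pi} ?D2) = 2 * moment f 0 y r"
    by simp
  then have "integral {0..pi} ?D1 + integral {0..pi} ?D2 = 2 * moment f 0 y r / r\<^sup>2"
    using r by (simp add: field_simps power2_eq_square)
  then show "(N has_real_derivative 2 * moment f 0 y r / r\<^sup>2) (at r)"
    using N' by simp
qed

lemma moment_bounded:
  assumes "continuous_on H2_closed f"
  obtains B where "B \<ge> 0" "\<And>r. 0 < r \<Longrightarrow> r \<le> 1 \<Longrightarrow> \<bar>moment f k y r\<bar> \<le> B"
proof -
  have "\<exists>B. \<forall>r\<in>{0..1}. \<bar>moment f k y r\<bar> \<le> B"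
    unfolding moment_def
    by (rule integral_polar_bounded[OF assms]) (intro continuous_intros)
  then obtain B where B: "\<forall>r\<in>{0..1}. \<bar>moment f k y r\<bar> \<le> B" ..
  show ?thesis
  proof (rule that[of B])
    show "B \<ge> 0"
      using bspec[OF B, of 1] by simp
  qed (use B in auto)
qed

text \<open>
  Uniqueness of the Fuchsian equation \<open>M'' = 2 M / r\<^sup>2\<close>, whose other solution \<open>1 / r\<close> is unbounded.
\<close>

lemma zeroth_moment_quadratic:
  assumes f: "half_grad f X Y" and X: "half_grad X XX XY" and Y: "half_grad Y YX YY"
    and z: "\<And>y. f (0, y) = 0"
    and pde: "\<And>p. p \<in> H2_closed \<Longrightarrow> fst p * (XX p + YY p) = X p"
  shows "\<exists>a. \<forall>r>0. moment f 0 y r = a * r\<^sup>2"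
proof -
  define M where "M = moment f 0 y"
  define N where "N = (\<lambda>r. integral {0..pi} (\<lambda>\<theta>. X (polar y r \<theta>) * (sin \<theta>)\<^sup>2)
    + integral {0..pi} (\<lambda>\<theta>. Y (polar y r \<theta>) * (sin \<theta> * cos \<theta>)))"
  have M': "(M has_real_derivative N r) (at r)" if "r > 0" for r
    unfolding M_def N_def by (rule zeroth_moment_second_derivative(1)[OF f X Y that z pde])
  have N': "(N has_real_derivative 2 * M r / r\<^sup>2) (at r)" if "r > 0" for r
    unfolding M_def N_def by (rule zeroth_moment_second_derivative(2)[OF f X Y that z pde])
  \<comment> \<open>A first integral: the general solution \<open>a r^2 + b / r\<close> makes
    \<open>r M = a r^3 + b\<close>, whose derivative divided by \<open>r^2\<close> is the constant
    \<open>3 a\<close>.\<close>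
  have "((\<lambda>r. (r * N r + M r) / r\<^sup>2) has_real_derivative 0) (at r)" if "r > 0" for r
  proof -
    have "((\<lambda>r. r * N r + M r) has_real_derivative (1 * N r + 2 * M r / r\<^sup>2 * r) + N r) (at r)"
      by (intro DERIV_add DERIV_mult DERIV_ident M' N' that)
    moreover have "((\<lambda>r. r\<^sup>2) has_real_derivative 2 * r) (at r)"
      by (auto intro!: derivative_eq_intros)
    ultimately show ?thesis
      by (rule DERIV_cong[OF DERIV_divide]) (use that in \<open>auto simp: field_simps power2_eq_square\<close>)
  qed
  then have "\<exists>c. \<forall>r\<in>{0<..}. (r * N r + M r) / r\<^sup>2 = c"
    by (intro has_field_derivative_zero_constant) (auto simp: has_field_derivative_at_within)
  then obtain c where "\<And>r. r > 0 \<Longrightarrow> (r * N r + M r) / r\<^sup>2 = c"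
    by auto
  then have c: "\<And>r. r > 0 \<Longrightarrow> r * N r + M r = c * r\<^sup>2"
    by (simp add: field_simps)
  obtain B where B: "B \<ge> 0" "\<And>r. 0 < r \<Longrightarrow> r \<le> 1 \<Longrightarrow> \<bar>M r\<bar> \<le> B"
    using moment_bounded[OF half_gradD(1)[OF f]] unfolding M_def by blast
  \<comment> \<open>This difference is the coefficient of the singular solution
    \<open>1 / r\<close>; a bounded \<open>M\<close> makes it of order \<open>r\<close>.\<close>
  have "r * M r - c / 3 * r ^ 3 = 0" if r: "r > 0" for r
  proof (rule constant_vanishing_at_0[OF _ _ r, where g = "\<lambda>r. r * M r - c / 3 * r ^ 3"])
    show "((\<lambda>r. r * M r - c / 3 * r ^ 3) has_real_derivative 0) (at r)" if "r > 0" for r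
    proof -
      have "((\<lambda>r. c / 3 * r ^ 3) has_real_derivative c * r\<^sup>2) (at r)"
        by (auto intro!: derivative_eq_intros)
      with DERIV_mult[OF DERIV_ident M'[OF that]] show ?thesis
        by (rule DERIV_cong[OF DERIV_diff]) (use c[OF that] in \<open>simp add: algebra_simps\<close>)
    qed
    show "\<bar>r * M r - c / 3 * r ^ 3\<bar> \<le> (B + \<bar>c\<bar>) * r" if "0 < r" "r \<le> 1" for r
    proof -
      have "\<bar>r * M r - c / 3 * r ^ 3\<bar> \<le> \<bar>r * M r\<bar> + \<bar>c / 3 * r ^ 3\<bar>"
        by simp
      also have "\<bar>r * M r\<bar> \<le> r * B"
        using B(2)[OF that] that by (simp add: abs_mult)
      also have "\<bar>c / 3 * r ^ 3\<bar> \<le> \<bar>c\<bar> * r"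
      proof -
        have "r ^ 3 \<le> r"
          using power_decreasing[of 1 3 r] that by simp
        then have "\<bar>c\<bar> * r ^ 3 \<le> \<bar>c\<bar> * r"
          by (rule mult_left_mono) simp
        moreover have "0 \<le> \<bar>c\<bar> * r"
          using that by simp
        moreover have "\<bar>c / 3 * r ^ 3\<bar> = \<bar>c\<bar> * r ^ 3 / 3"
          using that by (simp add: abs_mult)
        ultimately show ?thesis
          by linarith
      qed
      finally show ?thesis by (simp add: algebra_simps)
    qed
  qed
  then have "M r = c / 3 * r\<^sup>2" if "r > 0" for r
    using that by (auto simp: power2_eq_square power3_eq_cube algebra_simps)
  then show ?thesis
    unfolding M_def by blast
qed

section \<open>The first moment and positivity\<close>

text \<open>The recurrence at \<open>k = 0\<close> reads \<open>M' + 2 M / r = b r^2\<close>. Its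
  integrating factor is \<open>r^2\<close>, so \<open>r^2 M\<close> has derivative
  \<open>b r^4\<close> and equals \<open>b r^5 / 5\<close> once boundedness removes the
  constant.\<close>

lemma first_moment_cubic:
  assumes f: "half_grad f X Y" and z: "\<And>y. f (0, y) = 0"
    and Y: "\<And>r. r > 0 \<Longrightarrow> moment Y 0 y r = b * r\<^sup>2" and r: "r > 0"
  shows "moment f 1 y r = b * r ^ 3 / 5"
proof -
  define M where "M = moment f 1 y"
  have M': "(M has_real_derivative b * r\<^sup>2 - 2 * M r / r) (at r)" if "r > 0" for r
    using moment_radial_derivative[OF f that z, of 0 y] Y[OF that] by (simp add: M_def)
  obtain B where B: "B \<ge> 0" "\<And>r. 0 < r \<Longrightarrow> r \<le> 1 \<Longrightarrow> \<bar>M r\<bar> \<le> B"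
    using moment_bounded[OF half_gradD(1)[OF f], of 1 y] unfolding M_def by blast
  have "r\<^sup>2 * M r - b / 5 * r ^ 5 = 0"
  proof (rule constant_vanishing_at_0[OF _ _ r, where g = "\<lambda>r. r\<^sup>2 * M r - b / 5 * r ^ 5"])
    show "((\<lambda>r. r\<^sup>2 * M r - b / 5 * r ^ 5) has_real_derivative 0) (at r)" if "r > 0" for r
    proof -
      have "((\<lambda>r. b / 5 * r ^ 5) has_real_derivative b * r ^ 4) (at r)"
        "((\<lambda>r. r\<^sup>2) has_real_derivative 2 * r) (at r)"
        by (auto intro!: derivative_eq_intros)
      then show ?thesis
        by (intro DERIV_cong[OF DERIV_diff[OF DERIV_mult[OF _ M'[OF that]]]])
          (use that in \<open>auto simp: algebra_simps power2_eq_square power4_eq_xxxx\<close>)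
    qed
    show "\<bar>r\<^sup>2 * M r - b / 5 * r ^ 5\<bar> \<le> (B + \<bar>b\<bar>) * r" if "0 < r" "r \<le> 1" for r
    proof -
      have le: "r ^ 5 \<le> r" "r\<^sup>2 \<le> r"
        using power_decreasing[of 1 5 r] power_decreasing[of 1 2 r] that by simp_all
      have "\<bar>r\<^sup>2 * M r\<bar> \<le> r * B"
        using B(2)[OF that] le that by (auto simp: abs_mult intro!: mult_mono)
      moreover have "\<bar>b / 5 * r ^ 5\<bar> = \<bar>b\<bar> * r ^ 5 / 5"
        using that by (simp add: abs_mult)
      moreover have "\<bar>b\<bar> * r ^ 5 \<le> \<bar>b\<bar> * r" "0 \<le> \<bar>b\<bar> * r"
        using that by (auto intro!: mult_left_mono le)
      ultimately have "\<bar>r\<^sup>2 * M r - b / 5 * r ^ 5\<bar> \<le> r * B + \<bar>b\<bar> * r"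
        by linarith
      then show ?thesis
        by (simp add: algebra_simps)
    qed
  qed
  then have "r\<^sup>2 * M r = r\<^sup>2 * (b * r ^ 3 / 5)"
    by (simp add: power2_eq_square power3_eq_cube numeral_eq_Suc)
  then show ?thesis
    using r by (simp add: M_def)
qed

lemma abs_first_moment_le:
  assumes "continuous_on H2_closed f" "\<And>p. p \<in> H2_closed \<Longrightarrow> f p \<ge> 0" "r > 0"
  shows "\<bar>moment f 1 y r\<bar> \<le> moment f 0 y r"
proof -
  have "norm (integral {0..pi} (\<lambda>\<theta>. f (polar y r \<theta>) * (sin \<theta> * cos \<theta> ^ 1))) \<le>
    integral {0..pi} (\<lambda>\<theta>. f (polar y r \<theta>) * (sin \<theta> * cos \<theta> ^ 0))"
  proof (rule integral_norm_bound_integral)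
    fix \<theta> :: real assume \<theta>: "\<theta> \<in> {0..pi}"
    then have "0 \<le> f (polar y r \<theta>) * sin \<theta>"
      using assms(2)[OF polar_mem_closed[of r \<theta> y]] assms(3) by (auto intro!: mult_nonneg_nonneg sin_ge_zero)
    then have "\<bar>f (polar y r \<theta>) * sin \<theta>\<bar> * \<bar>cos \<theta>\<bar> \<le> f (polar y r \<theta>) * sin \<theta> * 1"
      by (intro mult_mono) auto
    then show "norm (f (polar y r \<theta>) * (sin \<theta> * cos \<theta> ^ 1)) \<le> f (polar y r \<theta>) * (sin \<theta> * cos \<theta> ^ 0)"
      by (simp add: abs_mult)
  qed (rule has_integral_integrable[OF moment_has_integral[OF assms(1,3)]])+
  then show ?thesis
    by (simp add: moment_def)
qed

text \<open>
  A variation of the leading coefficient in \<open>y\<close> would make the first moment grow like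
  \<open>r\<^sup>3\<close>, while positivity bounds it by the zeroth moment, which grows like \<open>r\<^sup>2\<close>.
\<close>

lemma nonneg_zeroth_moment_uniform:
  assumes f: "half_grad f X Y" and z: "\<And>y. f (0, y) = 0"
    and nn: "\<And>p. p \<in> H2_closed \<Longrightarrow> f p \<ge> 0"
    and q: "\<And>y. \<exists>a. \<forall>r>0. moment f 0 y r = a * r\<^sup>2"
  shows "\<exists>a\<ge>0. \<forall>y. \<forall>r>0. moment f 0 y r = a * r\<^sup>2"
proof -
  \<comment> \<open>Reading the coefficient off at radius 1 makes it a differentiable function of
    the centre.\<close>
  define a where "a = (\<lambda>y. moment f 0 y 1)"
  have a: "moment f 0 y r = a y * r\<^sup>2" if "r > 0" for y r
    using q[of y] that by (auto simp: a_def)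
  have "(a has_real_derivative 0) (at y)" for y
  proof -
    define b where "b = moment Y 0 y 1"
    have a': "(a has_real_derivative b) (at y)"
      unfolding a_def b_def by (rule moment_centre_derivative[OF f _ z]) simp
    \<comment> \<open>The two sides are the derivative in \<open>y\<close> of the zeroth moment,
      computed under the integral and from \<open>a y * r^2\<close>.\<close>
    have mY: "moment Y 0 y r = b * r\<^sup>2" if "r > 0" for r
    proof (rule DERIV_unique)
      show "((\<lambda>y. moment f 0 y r) has_real_derivative moment Y 0 y r) (at y)"
        by (rule moment_centre_derivative[OF f that z])
      show "((\<lambda>y. moment f 0 y r) has_real_derivative b * r\<^sup>2) (at y)"
        unfolding a[OF that] by (rule DERIV_cmult_right[OF a'])
    qed
    have le: "\<bar>b\<bar> * r \<le> 5 * a y" if "r > 0" for r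
    proof -
      have "moment f 1 y r = b * r ^ 3 / 5"
        by (rule first_moment_cubic[OF f z mY that])
      moreover have "\<bar>moment f 1 y r\<bar> \<le> moment f 0 y r"
        by (rule abs_first_moment_le[OF half_gradD(1)[OF f] nn that])
      ultimately have "\<bar>b * r ^ 3 / 5\<bar> \<le> a y * r\<^sup>2"
        using a[OF that] by simp
      then have "(\<bar>b\<bar> * r) * r\<^sup>2 \<le> (5 * a y) * r\<^sup>2"
        using that by (simp add: abs_mult power2_eq_square power3_eq_cube)
      then show ?thesis
        using that by simp
    qed
    have "b = 0"
    proof (rule ccontr)
      assume "b \<noteq> 0"
      moreover have "0 \<le> a y"
        using le[of 1] by simp
      ultimately show False
        \<comment> \<open>At this radius the bound would read
          \<open>5 * a y + 1 \<le> 5 * a y\<close>; \<open>0 \<le> a y\<close> ensures that the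
          radius is positive.\<close>
        using le[of "(5 * a y + 1) / \<bar>b\<bar>"] by simp
    qed
    then show ?thesis using a' by simp
  qed
  then have const: "a y = a 0" for y
    by (rule DERIV_isconst_all[rule_format])
  have "\<bar>moment f 1 0 1\<bar> \<le> moment f 0 0 1"
    by (rule abs_first_moment_le[OF half_gradD(1)[OF f] nn]) simp_all
  then have "0 \<le> a 0"
    by (simp add: a_def)
  then show ?thesis
    using a const by metis
qed

section \<open>Vanishing and completeness of the moments\<close>

text \<open>Strong induction through the recurrence. If the lower moments are zero for every centre,
  so are their derivatives in \<open>y\<close>, and moment \<open>m + 1\<close> satisfies
  \<open>M' = -(m + 2) M / r\<close>. Thus \<open>r^(m + 2) M\<close> is constant, and boundedness
  at the centre makes it zero.\<close>

lemma moments_vanish: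
  assumes f: "half_grad f X Y" and z: "\<And>y. f (0, y) = 0"
    and m0: "\<And>y r. r > 0 \<Longrightarrow> moment f 0 y r = 0" and r: "r > 0"
  shows "moment f k y r = 0"
  using r
proof (induction k arbitrary: y r rule: less_induct)
  case (less k)
  show ?case
  proof (cases k)
    case 0
    then show ?thesis using m0 less.prems by simp
  next
    case (Suc m)
    define M where "M = moment f k y"
    have M': "(M has_real_derivative - (real (m + 2) * M r / r)) (at r)" if "r > 0" for r
    proof -
      have "moment Y m y r = 0"
      proof (rule DERIV_unique)
        show "((\<lambda>y. moment f m y r) has_real_derivative moment Y m y r) (at y)"
          by (rule moment_centre_derivative[OF f that z])
        show "((\<lambda>y. moment f m y r) has_real_derivative 0) (at y)"
          using less.IH[of m r] Suc that by simp
      qed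
      \<comment> \<open>For \<open>m = 0\<close> the truncated index is 0 again, which is still
        below \<open>k\<close>.\<close>
      moreover have "moment f (m - 1) y r = 0"
        using less.IH[of "m - 1" r y] Suc that by simp
      ultimately show ?thesis
        unfolding M_def Suc
        by (intro DERIV_cong[OF moment_radial_derivative[OF f that z]]) simp
    qed
    obtain B where B: "B \<ge> 0" "\<And>r. 0 < r \<Longrightarrow> r \<le> 1 \<Longrightarrow> \<bar>M r\<bar> \<le> B"
      using moment_bounded[OF half_gradD(1)[OF f], of k y] unfolding M_def by blast
    have "r ^ (m + 2) * M r = 0"
    proof (rule constant_vanishing_at_0[OF _ _ less.prems, where g = "\<lambda>r. r ^ (m + 2) * M r"])
      show "((\<lambda>r. r ^ (m + 2) * M r) has_real_derivative 0) (at r)" if "r > 0" for r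
      proof -
        have "((\<lambda>r. r ^ (m + 2)) has_real_derivative real (m + 2) * r ^ (m + 1)) (at r)"
          using DERIV_pow[of "m + 2" r UNIV] by simp
        from DERIV_mult[OF this M'[OF that]] show ?thesis
          by (rule DERIV_cong) (use that in \<open>simp add: field_simps\<close>)
      qed
      show "\<bar>r ^ (m + 2) * M r\<bar> \<le> B * r" if "0 < r" "r \<le> 1" for r
      proof -
        have "r ^ (m + 2) \<le> r"
          using power_decreasing[of 1 "m + 2" r] that by simp
        then have "r ^ (m + 2) * \<bar>M r\<bar> \<le> r * B"
          using B(2)[OF that] that by (intro mult_mono) auto
        then show ?thesis
          using that by (simp add: abs_mult mult.commute)
      qed
    qed
    then show ?thesis
      using less.prems by (simp add: M_def)
  qed
qed

text \<open>Weierstrass approximation in \<open>t = cos \<theta>\<close>: \<open>F\<close> is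
  orthogonal, with weight \<open>sin \<theta>\<close>, to all polynomials in
  \<open>cos \<theta>\<close>. If \<open>p\<close> is within \<open>e\<close> of
  \<open>F (arccos t)\<close>, subtracting \<open>p (cos \<theta>)\<close> from one factor of
  \<open>F^2\<close> bounds its weighted integral by \<open>e\<close> times that of
  \<open>\<bar>F\<bar>\<close>.\<close>

lemma cos_moments_determine:
  assumes F: "continuous_on {0..pi} F"
    and m: "\<And>k. integral {0..pi} (\<lambda>\<theta>. F \<theta> * (sin \<theta> * cos \<theta> ^ k)) = 0"
    and \<theta>: "0 < \<theta>" "\<theta> < pi"
  shows "F \<theta> = (0::real)"
proof -
  let ?C = "integral {0..pi} (\<lambda>\<theta>. \<bar>F \<theta>\<bar> * sin \<theta>)"
  have int: "(\<lambda>\<theta>. F \<theta> * (sin \<theta> * cos \<theta> ^ k)) integrable_on {0..pi}" for k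
    by (intro integrable_continuous_real continuous_intros F)
  have intC: "(\<lambda>\<theta>. \<bar>F \<theta>\<bar> * sin \<theta>) integrable_on {0..pi}"
    by (intro integrable_continuous_real continuous_intros F)
  have cont: "continuous_on {0..pi} (\<lambda>\<theta>. F \<theta> * F \<theta> * sin \<theta>)"
    by (intro continuous_intros F)
  note intF = integrable_continuous_real[OF cont]
  have le: "integral {0..pi} (\<lambda>\<theta>. F \<theta> * F \<theta> * sin \<theta>) \<le> e * ?C" if "e > 0" for e
  proof -
    have "continuous_on {-1..1} (\<lambda>t. F (arccos t))"
      by (intro continuous_on_compose2[OF F] continuous_on_arccos' image_subsetI) (auto simp: arccos_lbound arccos_ubound)
    from Stone_Weierstrass_real_polynomial_function[OF compact_Icc this that]
    obtain p where "real_polynomial_function p" and p: "\<And>t. t \<in> {-1..1} \<Longrightarrow> \<bar>F (arccos t) - p t\<bar> < e"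
      by blast
    then obtain c n where pc: "p = (\<lambda>x. \<Sum>i\<le>n. c i * x ^ i)"
      by (auto simp: real_polynomial_function_iff_sum)
    have eq: "F \<theta> * sin \<theta> * p (cos \<theta>) = (\<Sum>i\<le>n. c i * (F \<theta> * (sin \<theta> * cos \<theta> ^ i)))" for \<theta>
      by (simp add: pc sum_distrib_left algebra_simps)
    have "((\<lambda>\<theta>. F \<theta> * (sin \<theta> * cos \<theta> ^ i)) has_integral 0) {0..pi}" for i
      using integrable_integral[OF int[of i]] m[of i] by simp
    then have "((\<lambda>\<theta>. \<Sum>i\<le>n. c i * (F \<theta> * (sin \<theta> * cos \<theta> ^ i))) has_integral (\<Sum>i\<le>n. c i * 0)) {0..pi}"
      by (intro has_integral_sum has_integral_mult_right) auto
    then have p0: "((\<lambda>\<theta>. F \<theta> * sin \<theta> * p (cos \<theta>)) has_integral 0) {0..pi}"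
      unfolding eq by simp
    have "((\<lambda>\<theta>. F \<theta> * F \<theta> * sin \<theta> - F \<theta> * sin \<theta> * p (cos \<theta>))
        has_integral integral {0..pi} (\<lambda>\<theta>. F \<theta> * F \<theta> * sin \<theta>) - 0) {0..pi}"
      by (rule has_integral_diff[OF integrable_integral[OF intF] p0])
    moreover have "((\<lambda>\<theta>. e * (\<bar>F \<theta>\<bar> * sin \<theta>)) has_integral e * ?C) {0..pi}"
      by (rule has_integral_mult_right[OF integrable_integral[OF intC]])
    moreover have "F \<theta> * F \<theta> * sin \<theta> - F \<theta> * sin \<theta> * p (cos \<theta>) \<le> e * (\<bar>F \<theta>\<bar> * sin \<theta>)"
      if "\<theta> \<in> {0..pi}" for \<theta>
    proof -
      have s: "sin \<theta> \<ge> 0"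
        using that by (simp add: sin_ge_zero)
      have "\<bar>F \<theta> - p (cos \<theta>)\<bar> \<le> e"
        using p[of "cos \<theta>"] that by (simp add: arccos_cos less_imp_le)
      then have "\<bar>F \<theta> * (F \<theta> - p (cos \<theta>))\<bar> \<le> \<bar>F \<theta>\<bar> * e"
        unfolding abs_mult by (intro mult_left_mono) auto
      then have "F \<theta> * (F \<theta> - p (cos \<theta>)) * sin \<theta> \<le> \<bar>F \<theta>\<bar> * e * sin \<theta>"
        by (intro mult_right_mono s) linarith
      then show ?thesis
        by (simp add: algebra_simps)
    qed
    ultimately have "integral {0..pi} (\<lambda>\<theta>. F \<theta> * F \<theta> * sin \<theta>) - 0 \<le> e * ?C"
      by (rule has_integral_le)
    then show ?thesis
      by simp
  qed
  have nn: "F \<theta> * F \<theta> * sin \<theta> \<ge> 0" if "\<theta> \<in> {0..pi}" for \<theta>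
    using that by (simp add: sin_ge_zero)
  have "integral {0..pi} (\<lambda>\<theta>. F \<theta> * F \<theta> * sin \<theta>) \<le> 0 + e" if "e > 0" for e
  proof -
    have C: "?C \<ge> 0"
      by (intro integral_nonneg intC) (auto intro!: mult_nonneg_nonneg sin_ge_zero)
    \<comment> \<open>The tolerance is divided by \<open>?C + 1\<close> rather than
      \<open>?C\<close>, which may be zero.\<close>
    have "integral {0..pi} (\<lambda>\<theta>. F \<theta> * F \<theta> * sin \<theta>) \<le> e / (?C + 1) * ?C"
      using le[of "e / (?C + 1)"] C that by simp
    also have "\<dots> \<le> e"
      using C that by (simp add: field_simps)
    finally show ?thesis by simp
  qed
  then have "integral {0..pi} (\<lambda>\<theta>. F \<theta> * F \<theta> * sin \<theta>) \<le> 0"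
    by (rule field_le_epsilon)
  moreover have "integral {0..pi} (\<lambda>\<theta>. F \<theta> * F \<theta> * sin \<theta>) \<ge> 0"
    by (intro integral_nonneg intF nn)
  ultimately have "integral {0..pi} (\<lambda>\<theta>. F \<theta> * F \<theta> * sin \<theta>) = 0"
    by simp
  then have "F \<theta> * F \<theta> * sin \<theta> = 0"
    using integral_eq_0_iff[OF cont pi_gt_zero nn] \<theta> by auto
  moreover have "sin \<theta> > 0"
    using \<theta> by (rule sin_gt_zero)
  ultimately show ?thesis
    by simp
qed

section \<open>Recovering the quadratic\<close>

text \<open>The normalisation: since \<open>x = r sin \<theta>\<close>, the zeroth moment of
  \<open>x^2\<close> is \<open>4 / 3 * r^2\<close>, whence the factor \<open>3 / 4\<close>
  below.\<close>

lemma integral_sin_cubed: "integral {0..pi} (\<lambda>\<theta>. sin \<theta> ^ 3) = (4 / 3 :: real)"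
proof -
  have "((\<lambda>\<theta>. sin \<theta> ^ 3) has_integral (cos pi ^ 3 / 3 - cos pi) - (cos 0 ^ 3 / 3 - cos 0)) {0..pi::real}"
  proof (rule fundamental_theorem_of_calculus)
    fix \<theta> :: real
    have "((\<lambda>\<theta>. cos \<theta> ^ 3 / 3 - cos \<theta>) has_real_derivative sin \<theta> - (cos \<theta>)\<^sup>2 * sin \<theta>) (at \<theta>)"
      by (auto intro!: derivative_eq_intros)
    also have "sin \<theta> - (cos \<theta>)\<^sup>2 * sin \<theta> = (1 - (cos \<theta>)\<^sup>2) * sin \<theta>"
      by (simp add: algebra_simps)
    also have "\<dots> = sin \<theta> ^ 3"
      by (simp only: sin_squared_eq[symmetric]) (simp add: power3_eq_cube power2_eq_square)
    finally show "((\<lambda>\<theta>. cos \<theta> ^ 3 / 3 - cos \<theta>) has_vector_derivative sin \<theta> ^ 3) (at \<theta> within {0..pi})"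
      by (simp add: has_real_derivative_iff_has_vector_derivative has_vector_derivative_at_within)
  qed simp
  then show ?thesis
    by (simp add: integral_unique)
qed

lemma half_grad_minus_square:
  assumes "half_grad f X Y"
  shows "half_grad (\<lambda>p. f p - A * (fst p)\<^sup>2) (\<lambda>p. X p - 2 * A * fst p) Y"
  unfolding half_grad_def
proof (intro conjI ballI)
  note c = half_gradD[OF assms]
  show "continuous_on H2_closed (\<lambda>p. f p - A * (fst p)\<^sup>2)" "continuous_on H2_closed (\<lambda>p. X p - 2 * A * fst p)"
    "continuous_on H2_closed Y"
    by (intro continuous_intros c)+
  show "((\<lambda>p. f p - A * (fst p)\<^sup>2) has_derivative (\<lambda>v. (X p - 2 * A * fst p) * fst v + Y p * snd v)) (at p)"
    if "p \<in> H2" for p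
    by (rule derivative_eq_intros c(4) that refl ext)+ (simp add: algebra_simps)
qed

text \<open>Subtracting the multiple of \<open>x^2\<close> with the same zeroth moment leaves a
  function to which \<open>moments_vanish\<close> applies. Completeness on each half-circle then
  makes it zero.\<close>

lemma quadratic_of_zeroth_moment:
  assumes f: "half_grad f X Y" and z: "\<And>y. f (0, y) = 0"
    and a: "\<And>y r. r > 0 \<Longrightarrow> moment f 0 y r = a * r\<^sup>2" and x: "x > 0"
  shows "f (x, y) = 3 / 4 * a * x\<^sup>2"
proof -
  define w where "w = (\<lambda>p. f p - 3 / 4 * a * (fst p)\<^sup>2)"
  have w: "half_grad w (\<lambda>p. X p - 2 * (3 / 4 * a) * fst p) Y"
    unfolding w_def by (rule half_grad_minus_square[OF f])
  have wz: "w (0, y) = 0" for y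
    by (simp add: w_def z)
  have m0: "moment w 0 y r = 0" if "r > 0" for y r
  proof -
    have "((\<lambda>\<theta>. sin \<theta> ^ 3) has_integral 4 / 3) {0..pi::real}"
      unfolding integral_sin_cubed[symmetric]
      by (intro integrable_integral integrable_continuous_real continuous_intros)
    from has_integral_diff[OF moment_has_integral[OF half_gradD(1)[OF f] that, of y 0]
        has_integral_mult_right[OF this, of "3 / 4 * a * r\<^sup>2"]]
    have "((\<lambda>\<theta>. w (polar y r \<theta>) * (sin \<theta> * cos \<theta> ^ 0)) has_integral 0) {0..pi}"
      by (simp add: a[OF that] w_def polar_def algebra_simps power2_eq_square power3_eq_cube)
    then show ?thesis
      by (simp add: moment_def integral_unique)
  qed
  have "integral {0..pi} (\<lambda>\<theta>. w (polar y x \<theta>) * (sin \<theta> * cos \<theta> ^ k)) = 0" for k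
    unfolding moment_def[symmetric] by (rule moments_vanish[OF w wz m0 x])
  moreover have "continuous_on {0..pi} (\<lambda>\<theta>. w (polar y x \<theta>))"
    using x by (intro continuous_on_polar[OF half_gradD(1)[OF w]] continuous_intros) auto
  \<comment> \<open>The half-circle of radius \<open>x\<close> about \<open>(0, y)\<close> meets
    \<open>(x, y)\<close> at its midpoint.\<close>
  ultimately have "w (polar y x (pi / 2)) = 0"
    by (intro cos_moments_determine[where F = "\<lambda>\<theta>. w (polar y x \<theta>)"]) auto
  then show ?thesis
    by (simp add: w_def polar_def)
qed

section \<open>From iterated partial derivatives to the theorem\<close>

text \<open>Continuity of the partials upgrades them to a total derivative. The function
  \<open>g\<close> need only agree with \<open>f\<close> inside, so that the lemma also applies to
  the extension of a first partial, whose boundary values are not those of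
  \<open>deriv\<close>.\<close>

lemma half_grad_of_partials:
  assumes g: "continuous_on H2_closed g" "\<And>p. p \<in> H2 \<Longrightarrow> g p = case_prod f p"
    and X: "continuous_on H2_closed X" "\<And>p. p \<in> H2 \<Longrightarrow> X p = case_prod (dx f) p"
    and Y: "continuous_on H2_closed Y" "\<And>p. p \<in> H2 \<Longrightarrow> Y p = case_prod (dy f) p"
    and p: "partials_exist_on H2 f"
  shows "half_grad g X Y"
  unfolding half_grad_def
proof (intro conjI ballI g(1) X(1) Y(1))
  fix q assume q: "q \<in> H2"
  obtain x y where xy: "q = (x, y)" "x > 0"
    using q by (cases q) (auto simp: H2_def)
  have H2: "H2 = {0<..} \<times> UNIV"
    by (auto simp: H2_def)
  have fx: "((\<lambda>t. f t y) has_derivative (*) (X (x, y))) (at x within {0<..})"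
  proof -
    have "(\<lambda>t. f t y) differentiable (at x)"
      using p q xy by (auto simp: partials_exist_on_def)
    then have "((\<lambda>t. f t y) has_real_derivative X (x, y)) (at x)"
      using X(2)[OF q] xy by (simp add: dx_def DERIV_deriv_iff_real_differentiable)
    then show ?thesis
      by (simp add: has_field_derivative_def has_derivative_at_withinI)
  qed
  have fy: "((\<lambda>t. f u t) has_derivative blinfun_apply (blinfun_mult_right (Y (u, v)))) (at v within UNIV)"
    if "u \<in> {0<..}" for u v
  proof -
    have uv: "(u, v) \<in> H2"
      using that by (simp add: H2_def)
    have "(\<lambda>t. f u t) differentiable (at v)"
      using p uv by (auto simp: partials_exist_on_def)
    then have "((\<lambda>t. f u t) has_real_derivative Y (u, v)) (at v)"
      using Y(2)[OF uv] by (simp add: dy_def DERIV_deriv_iff_real_differentiable)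
    then show ?thesis
      by (simp add: has_field_derivative_def)
  qed
  \<comment> \<open>The criterion used asks for continuity of the \<open>y\<close>-partial as a
    bounded linear map, and of the \<open>x\<close>-partial only existence at the point.\<close>
  have "continuous_on ({0<..} \<times> UNIV) (\<lambda>(x, y). blinfun_mult_right (Y (x, y)))"
    using continuous_on_subset[OF Y(1) H2_subset] unfolding H2
    by (auto simp: split_beta intro!: bounded_linear.continuous_on[OF bounded_linear_blinfun_mult_right])
  then have cy: "continuous (at (x, y) within {0<..} \<times> UNIV) (\<lambda>(x, y). blinfun_mult_right (Y (x, y)))"
    using xy unfolding continuous_on_eq_continuous_within by blast
  have "((\<lambda>(x, y). f x y) has_derivative (\<lambda>(tx, ty). X (x, y) * tx + blinfun_mult_right (Y (x, y)) ty))
      (at (x, y) within {0<..} \<times> UNIV)"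
    by (rule has_derivative_partialsI[OF fx fy cy]) auto
  moreover have "(\<lambda>(tx, ty). X (x, y) * tx + blinfun_mult_right (Y (x, y)) ty)
      = (\<lambda>v. X q * fst v + Y q * snd v)"
    by (auto simp: xy(1))
  ultimately have "(case_prod f has_derivative (\<lambda>v. X q * fst v + Y q * snd v)) (at q within H2)"
    by (simp only: H2 xy(1))
  then have "(case_prod f has_derivative (\<lambda>v. X q * fst v + Y q * snd v)) (at q)"
    by (simp only: at_within_open[OF q open_H2])
  then show "(g has_derivative (\<lambda>v. X q * fst v + Y q * snd v)) (at q)"
    by (rule has_derivative_transform_within_open[OF _ open_H2 q]) (simp add: g(2))
qed

lemma ext_contE:
  assumes "ext_cont H2 f"
  obtains g where "continuous_on H2_closed g" "\<And>p. p \<in> H2 \<Longrightarrow> g p = case_prod f p"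
  using assms by (auto simp: ext_cont_def closure_H2)

theorem theorem4p15:
  fixes \<phi> :: "real \<Rightarrow> real \<Rightarrow> real"
  assumes C2: "continuous_on H2_closed (case_prod \<phi>) \<and> Ck_upto 2 H2 \<phi>"
    and smooth: "smooth_on H2 \<phi>"
    and nonneg: "\<And>x y. x \<ge> 0 \<Longrightarrow> \<phi> x y \<ge> 0"
    and bdry: "\<And>y. \<phi> 0 y = 0"
    and pde: "\<And>x y. x > 0 \<Longrightarrow> dx (dx \<phi>) x y + dy (dy \<phi>) x y - (1 / x) * dx \<phi> x y = 0"
  shows "\<exists>A \<ge> 0. \<forall>x y. x \<ge> 0 \<longrightarrow> \<phi> x y = A * x\<^sup>2"
proof -
  let ?f = "case_prod \<phi>"
  have partials: "partials_exist_on H2 \<phi>" "partials_exist_on H2 (dx \<phi>)" "partials_exist_on H2 (dy \<phi>)"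
    and ext: "ext_cont H2 (dx \<phi>)" "ext_cont H2 (dy \<phi>)" "ext_cont H2 (dx (dx \<phi>))"
      "ext_cont H2 (dy (dx \<phi>))" "ext_cont H2 (dx (dy \<phi>))" "ext_cont H2 (dy (dy \<phi>))"
    using C2 by (simp_all add: numeral_2_eq_2)
  \<comment> \<open>On \<open>x = 0\<close> the value of \<open>dx \<phi>\<close> would depend on
    \<open>\<phi>\<close> outside the half-plane, so the continuous extensions are used from here
    on.\<close>
  obtain X where X: "continuous_on H2_closed X" "\<And>p. p \<in> H2 \<Longrightarrow> X p = case_prod (dx \<phi>) p"
    using ext_contE[OF ext(1)] by blast
  obtain Y where Y: "continuous_on H2_closed Y" "\<And>p. p \<in> H2 \<Longrightarrow> Y p = case_prod (dy \<phi>) p"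
    using ext_contE[OF ext(2)] by blast
  obtain XX where XX: "continuous_on H2_closed XX" "\<And>p. p \<in> H2 \<Longrightarrow> XX p = case_prod (dx (dx \<phi>)) p"
    using ext_contE[OF ext(3)] by blast
  obtain XY where XY: "continuous_on H2_closed XY" "\<And>p. p \<in> H2 \<Longrightarrow> XY p = case_prod (dy (dx \<phi>)) p"
    using ext_contE[OF ext(4)] by blast
  obtain YX where YX: "continuous_on H2_closed YX" "\<And>p. p \<in> H2 \<Longrightarrow> YX p = case_prod (dx (dy \<phi>)) p"
    using ext_contE[OF ext(5)] by blast
  obtain YY where YY: "continuous_on H2_closed YY" "\<And>p. p \<in> H2 \<Longrightarrow> YY p = case_prod (dy (dy \<phi>)) p"
    using ext_contE[OF ext(6)] by blast
  have f: "half_grad ?f X Y"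
    by (rule half_grad_of_partials[OF conjunct1[OF C2] refl X Y partials(1)])
  have gX: "half_grad X XX XY"
    by (rule half_grad_of_partials[OF X XX XY partials(2)])
  have gY: "half_grad Y YX YY"
    by (rule half_grad_of_partials[OF Y YX YY partials(3)])
  \<comment> \<open>Multiplied by \<open>x\<close>, the equation loses its singular coefficient and
    extends by continuity to the boundary, where it says \<open>X = 0\<close>.\<close>
  have pde': "fst p * (XX p + YY p) = X p" if "p \<in> H2_closed" for p
  proof -
    have "continuous_on (closure H2) (\<lambda>p. fst p * (XX p + YY p) - X p)"
      unfolding closure_H2 by (intro continuous_intros X XX YY)
    moreover have "fst p * (XX p + YY p) - X p = 0" if "p \<in> H2" for p
    proof -
      have "fst p > 0"
        using that by (simp add: H2_def)
      with pde[of "fst p" "snd p"] show ?thesis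
        by (simp add: X(2)[OF that] XX(2)[OF that] YY(2)[OF that] split_beta field_simps)
    qed
    ultimately have "fst p * (XX p + YY p) - X p = 0"
      using that unfolding closure_H2[symmetric] by (rule continuous_constant_on_closure)
    then show ?thesis by simp
  qed
  have z: "?f (0, y) = 0" for y
    by (simp add: bdry)
  have nn: "?f p \<ge> 0" if "p \<in> H2_closed" for p
    using that nonneg by (auto simp: H2_closed_def split: prod.split)
  have "\<exists>a. \<forall>r>0. moment ?f 0 y r = a * r\<^sup>2" for y
    by (rule zeroth_moment_quadratic[OF f gX gY z pde'])
  then have "\<exists>a\<ge>0. \<forall>y. \<forall>r>0. moment ?f 0 y r = a * r\<^sup>2"
    by (intro nonneg_zeroth_moment_uniform[OF f z nn])
  then obtain a where a: "a \<ge> 0" "\<And>y r. r > 0 \<Longrightarrow> moment ?f 0 y r = a * r\<^sup>2"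
    by blast
  have pos: "?f (x, y) = 3 / 4 * a * x\<^sup>2" if "x > 0" for x y
    by (rule quadratic_of_zeroth_moment[OF f z a(2) that])
  have "\<phi> x y = 3 / 4 * a * x\<^sup>2" if "x \<ge> 0" for x y
    using pos[of x y] that bdry by (cases "x = 0") auto
  then show ?thesis
    using a(1) by (intro exI[of _ "3 / 4 * a"]) simp
qed

end
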